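(* Let $G=(V,E,m,w)$ be a weighted graph with bounded geometry. If $G$ satisfies $\mathrm{CD}(0,\infty)$ outside $B_{R_0}(x_0)$ for some $x_0\in V$ and $R_0\in\mathbb{N}$, then $$\dim \mathcal{H}_0(G)\leq \sharp S_{R_0+1}(x_0)<\infty .$$
   Context: A weighted graph $G=(V,E,m,w)$ consists of a locally finite, simple, undirected, connected graph $(V,E)$, an edge weight $w:E\to(0,\infty)$, $w(x,y)=w(y,x)$, and a vertex weight $m:V\to(0,\infty)$. We write $x\sim y$ if $\{x,y\}\in E$, $\deg(x)=\sharp\{y\in V: y\sim x\}$, $d$ for the combinatorial graph distance, $B_R(x)=\{y\in V: d(y,x)\le R\}$, $S_R(x)=\{y\in V: d(y,x)=R\}$; $\sharp$ denotes the cardinality of a set. Bounded geometry: there is a constant $C>0$ with $\deg(x)\le C$ and $C^{-1}\le m(x)\le C$ for all $x\in V$, and $C^{-1}\le w(x,y)\le C$ for all $x,y\in V$ with $x\sim y$. The Laplacian is $\Delta f(x)=\sum_{y\sim x}\frac{w(x,y)}{m(x)}(f(y)-f(x))$ for $f:V\to\mathbb{R}$. $\mathcal{H}_0(G)$ is the real vector space of bounded functions $f:V\to\mathbb{R}$ with $\Delta f=0$ on $V$ (bounded harmonic functions). For $f,g:V\to\mathbb{R}$ put $\Gamma(f,g)=\frac12(\Delta(fg)-f\Delta g-g\Delta f)$, $\Gamma(f)=\Gamma(f,f)$, and $\Gamma_2(f)=\frac12\Delta\Gamma(f)-\Gamma(f,\Delta f)$. The Bakry-Émery curvature $\mathcal{K}^G_\infty(x)$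 at $x\in V$ is the maximal constant $K$ such that $\Gamma_2(f)(x)\ge K\,\Gamma(f)(x)$ for all $f:V\to\mathbb{R}$. For a finite $\Omega\subset V$, $G$ satisfies $\mathrm{CD}(0,\infty)$ outside $\Omega$ if $\mathcal{K}^G_\infty(x)\ge 0$ for all $x\in V\setminus\Omega$.
   Formalization: It is additionally assumed that B_{R_0}(x_0) is not all of V; otherwise S_{R_0+1}(x_0) is empty while the constants give dim H_0(G) ≥ 1, so the claim fails. *)

theory Defs
  imports "HOL-Analysis.Analysis" "HOL-Library.Function_Algebras"
begin

text \<open>The vertex set is the universe of the type \<open>'v\<close>. Only the values of the edge weight on
  adjacent pairs are ever used.\<close>

record 'v wgraph =
  adj :: "'v \<Rightarrow> 'v \<Rightarrow> bool"
  vweight :: "'v \<Rightarrow> real"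
  eweight :: "'v \<Rightarrow> 'v \<Rightarrow> real"

definition nbrs :: "'v wgraph \<Rightarrow> 'v \<Rightarrow> 'v set" where
  "nbrs G x = {y. adj G x y}"

definition weighted_graph :: "'v wgraph \<Rightarrow> bool" where
  "weighted_graph G \<longleftrightarrow>
     symp (adj G) \<and> irreflp (adj G) \<and>
     (\<forall>x. finite (nbrs G x)) \<and>
     (\<forall>x y. (adj G)\<^sup>*\<^sup>* x y) \<and>
     (\<forall>x. vweight G x > 0) \<and>
     (\<forall>x y. adj G x y \<longrightarrow> eweight G x y > 0 \<and> eweight G x y = eweight G y x)"

definition bounded_geometry :: "'v wgraph \<Rightarrow> bool" where
  "bounded_geometry G \<longleftrightarrow>
     (\<exists>C>0. (\<forall>x. real (card (nbrs G x)) \<le> C \<and> 1 / C \<le> vweight G x \<and> vweight G x \<le> C) \<and>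
            (\<forall>x y. adj G x y \<longrightarrow> 1 / C \<le> eweight G x y \<and> eweight G x y \<le> C))"

text \<open>The length of a shortest walk; meaningful because the graphs considered are connected.\<close>

definition gdist :: "'v wgraph \<Rightarrow> 'v \<Rightarrow> 'v \<Rightarrow> nat" where
  "gdist G x y = (LEAST n. (adj G ^^ n) x y)"

definition gball :: "'v wgraph \<Rightarrow> 'v \<Rightarrow> nat \<Rightarrow> 'v set" where
  "gball G x R = {y. gdist G y x \<le> R}"

definition gsphere :: "'v wgraph \<Rightarrow> 'v \<Rightarrow> nat \<Rightarrow> 'v set" where
  "gsphere G x R = {y. gdist G y x = R}"

definition laplacian :: "'v wgraph \<Rightarrow> ('v \<Rightarrow> real) \<Rightarrow> 'v \<Rightarrow> real" where
  "laplacian G f x = (\<Sum>y\<in>nbrs G x. eweight G x y / vweight G x * (f y - f x))"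

definition Gam :: "'v wgraph \<Rightarrow> ('v \<Rightarrow> real) \<Rightarrow> ('v \<Rightarrow> real) \<Rightarrow> 'v \<Rightarrow> real" where
  "Gam G f g x =
     1 / 2 * (laplacian G (\<lambda>y. f y * g y) x - f x * laplacian G g x - g x * laplacian G f x)"

definition Gam2 :: "'v wgraph \<Rightarrow> ('v \<Rightarrow> real) \<Rightarrow> 'v \<Rightarrow> real" where
  "Gam2 G f x = 1 / 2 * laplacian G (Gam G f f) x - Gam G f (laplacian G f) x"

definition curv_bound :: "'v wgraph \<Rightarrow> 'v \<Rightarrow> real \<Rightarrow> bool" where
  "curv_bound G x K \<longleftrightarrow> (\<forall>f. Gam2 G f x \<ge> K * Gam G f f x)"

text \<open>The maximal \<open>K\<close> with \<open>curv_bound G x K\<close>. The supremum is taken in the extended reals so that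
  an isolated vertex, where every \<open>K\<close> is admissible, gets \<open>\<infinity>\<close>; a finite supremum is attained, see
  \<open>be_curvature_greatest\<close>.\<close>

definition be_curvature :: "'v wgraph \<Rightarrow> 'v \<Rightarrow> ereal" where
  "be_curvature G x = Sup {ereal K |K. curv_bound G x K}"

lemma be_curvature_greatest:
  assumes "be_curvature G x = ereal K"
  shows "curv_bound G x K" and "curv_bound G x L \<Longrightarrow> L \<le> K"
proof -
  show "L \<le> K" if "curv_bound G x L"
  proof -
    have "ereal L \<le> be_curvature G x"
      unfolding be_curvature_def using that by (intro Sup_upper) blast
    then show ?thesis using assms by simp
  qed
  show "curv_bound G x K"
    unfolding curv_bound_def
  proof
    fix f
    let ?S = "{L. curv_bound G x L}"
    have "K \<in> closure ?S"
    proof (unfold closure_approachable, intro allI impI)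
      fix e :: real assume "e > 0"
      then have "ereal (K - e) < Sup {ereal K |K. curv_bound G x K}"
        using assms by (simp add: be_curvature_def)
      then obtain L where L: "curv_bound G x L" "K - e < L"
        by (auto simp: less_Sup_iff)
      moreover have "ereal L \<le> be_curvature G x"
        unfolding be_curvature_def using L(1) by (intro Sup_upper) blast
      ultimately show "\<exists>y\<in>?S. dist y K < e"
        using assms by (intro bexI[of _ L]) (auto simp: dist_real_def)
    qed
    moreover have "closed {L. L * Gam G f f x \<le> Gam2 G f x}"
      by (intro closed_Collect_le continuous_intros)
    moreover have "?S \<subseteq> {L. L * Gam G f f x \<le> Gam2 G f x}"
      by (auto simp: curv_bound_def)
    ultimately show "K * Gam G f f x \<le> Gam2 G f x"
      using closure_minimal by blast
  qed
qed

definition CD0_outside :: "'v wgraph \<Rightarrow> 'v set \<Rightarrow> bool" where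
  "CD0_outside G \<Omega> \<longleftrightarrow> (\<forall>x. x \<notin> \<Omega> \<longrightarrow> be_curvature G x \<ge> 0)"

definition bounded_harmonic :: "'v wgraph \<Rightarrow> ('v \<Rightarrow> real) set" where
  "bounded_harmonic G = {f. bounded (range f) \<and> (\<forall>x. laplacian G f x = 0)}"

text \<open>The real vector space of all functions on the vertices, with pointwise operations.\<close>

interpretation fun_space: vector_space "\<lambda>(c::real) (f::'v \<Rightarrow> real) x. c * f x"
  by unfold_locales (auto simp: fun_eq_iff algebra_simps)

lemma subspace_bounded_harmonic: "fun_space.subspace (bounded_harmonic G)"
proof (rule fun_space.subspaceI)
  show "0 \<in> bounded_harmonic G"
    by (auto simp: bounded_harmonic_def laplacian_def zero_fun_def image_constant_conv)
next
  fix f g assume fg: "f \<in> bounded_harmonic G" "g \<in> bounded_harmonic G"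
  then obtain a b where "\<forall>x. \<bar>f x\<bar> \<le> a" "\<forall>x. \<bar>g x\<bar> \<le> b"
    by (auto simp: bounded_harmonic_def bounded_iff)
  then have "\<forall>x. \<bar>(f + g) x\<bar> \<le> a + b"
    by (auto simp: plus_fun_def intro: order_trans[OF abs_triangle_ineq add_mono])
  then have "bounded (range (f + g))"
    by (auto simp: bounded_iff)
  moreover have "laplacian G (f + g) x = laplacian G f x + laplacian G g x" for x
    by (simp add: laplacian_def plus_fun_def algebra_simps flip: sum.distrib)
  ultimately show "f + g \<in> bounded_harmonic G"
    using fg by (simp add: bounded_harmonic_def)
next
  fix c :: real and f assume f: "f \<in> bounded_harmonic G"
  have "bounded (range (\<lambda>x. c * f x))"
    using f bounded_scaling[of "range f" c] by (simp add: bounded_harmonic_def image_image)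
  moreover have "laplacian G (\<lambda>x. c * f x) x = c * laplacian G f x" for x
    by (simp add: laplacian_def sum_distrib_left algebra_simps)
  ultimately show "(\<lambda>x. c * f x) \<in> bounded_harmonic G"
    using f by (simp add: bounded_harmonic_def)
qed

text \<open>\<open>fun_space.dim\<close> is \<open>0\<close> on infinite-dimensional subspaces, so bounds on it carry
  information only together with this predicate.\<close>

definition finite_dim :: "('v \<Rightarrow> real) set \<Rightarrow> bool" where
  "finite_dim U \<longleftrightarrow> (\<exists>B. finite B \<and> fun_space.span B = U)"

end

theory Submission
  imports Defs
begin

text \<open>The restriction map \<open>f \<mapsto> f|\<^bsub>S\<^esub>\<close> from the bounded harmonic functions to the functions on the sphere
  \<open>S = S\<^bsub>R0+1\<^esub>(x0)\<close> is injective, and \<open>S\<close> is finite; this gives the bound on the dimension.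

  For injectivity let \<open>f\<close> be bounded harmonic with \<open>f = 0\<close> on \<open>S\<close>. By the maximum principle on the
  finite ball \<open>B = B\<^bsub>R0\<^esub>(x0)\<close>, which is not the whole vertex set and whose outer boundary lies in \<open>S\<close>,
  the function \<open>f\<close> vanishes on \<open>B\<close> and on
  all neighbours of \<open>B\<close> (\<open>harmonic_zero_on_ball\<close>). Hence \<open>\<Gamma>(f) = 0\<close> on \<open>B\<close>, and since \<open>\<Gamma>(f) \<ge> 0\<close>
  everywhere, \<open>\<Delta>\<Gamma>(f) \<ge> 0\<close> on \<open>B\<close>. Outside \<open>B\<close> the curvature condition applied to the harmonic
  function \<open>f\<close> says \<open>\<Delta>\<Gamma>(f) = 2\<Gamma>\<^sub>2(f) \<ge> 0\<close>. So \<open>\<Gamma>(f)\<close> is subharmonic on the whole graph.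

  A bounded harmonic function \<open>f\<close> for which \<open>u = \<Gamma>(f)\<close> is subharmonic has \<open>u = 0\<close>
  (\<open>harmonic_Gam_subharmonic_imp_zero\<close>). Bounded geometry makes \<open>P = I + \<epsilon>\<Delta>\<close> a Markov operator for a
  small \<open>\<epsilon> > 0\<close>, so \<open>P\<close> preserves upper bounds. Since \<open>\<Delta>(f\<^sup>2) = 2u\<close> and \<open>\<Delta>u \<ge> 0\<close>, applying \<open>P\<close> to
  \<open>f\<^sup>2 + 2\<epsilon>n u \<le> M\<close> gives \<open>f\<^sup>2 + 2\<epsilon>(n+1) u \<le> M\<close>. Thus \<open>u \<le> M / (2\<epsilon>n)\<close> for all \<open>n > 0\<close>. By
  connectedness \<open>f\<close> is then constant, and the constant is its value \<open>0\<close> on \<open>B\<close>.\<close>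

section \<open>The Laplacian and the form \<open>\<Gamma>\<close>\<close>

lemma laplacian_add_scaled:
  "laplacian G (\<lambda>y. f y + c * g y) x = laplacian G f x + c * laplacian G g x"
  by (simp add: laplacian_def sum_distrib_left algebra_simps flip: sum.distrib)

lemma laplacian_uminus: "laplacian G (\<lambda>y. - f y) x = - laplacian G f x"
  using laplacian_add_scaled[of G "\<lambda>_. 0" "-1" f x] by (simp add: laplacian_def)

lemma Gam_self_eq:
  "Gam G f f x = 1 / 2 * (\<Sum>y\<in>nbrs G x. eweight G x y / vweight G x * (f y - f x)\<^sup>2)"
proof -
  have "laplacian G (\<lambda>y. f y * f y) x - f x * laplacian G f x - f x * laplacian G f x
      = (\<Sum>y\<in>nbrs G x. eweight G x y / vweight G x * (f y * f y - f x * f x)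
           - f x * (eweight G x y / vweight G x * (f y - f x))
           - f x * (eweight G x y / vweight G x * (f y - f x)))"
    by (simp add: laplacian_def sum_distrib_left sum_subtractf)
  also have "\<dots> = (\<Sum>y\<in>nbrs G x. eweight G x y / vweight G x * (f y - f x)\<^sup>2)"
    by (rule sum.cong) (simp_all add: power2_eq_square algebra_simps)
  finally show ?thesis by (simp add: Gam_def)
qed

lemma transition_rate_pos:
  assumes "weighted_graph G" "y \<in> nbrs G x"
  shows "eweight G x y / vweight G x > 0"
  using assms by (simp add: weighted_graph_def nbrs_def)

lemma Gam_self_nonneg:
  assumes "weighted_graph G"
  shows "Gam G f f x \<ge> 0"
proof -
  have "(\<Sum>y\<in>nbrs G x. eweight G x y / vweight G x * (f y - f x)\<^sup>2) \<ge> 0"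
    by (intro sum_nonneg mult_nonneg_nonneg less_imp_le[OF transition_rate_pos[OF assms]]) auto
  then show ?thesis by (simp add: Gam_self_eq)
qed

lemma laplacian_nonneg_at_zero:
  assumes "weighted_graph G" "g x = 0" "\<And>y. g y \<ge> 0"
  shows "laplacian G g x \<ge> 0"
  unfolding laplacian_def
proof (rule sum_nonneg)
  fix y assume "y \<in> nbrs G x"
  from transition_rate_pos[OF assms(1) this] show "0 \<le> eweight G x y / vweight G x * (g y - g x)"
    using assms(2,3) by (intro mult_nonneg_nonneg) auto
qed

lemma connected_adj_closed:
  assumes "weighted_graph G" "x \<in> A" "\<And>y z. y \<in> A \<Longrightarrow> adj G y z \<Longrightarrow> z \<in> A"
  shows "A = UNIV"
proof -
  have "z \<in> A" for z
  proof -
    have "(adj G)\<^sup>*\<^sup>* x z" using assms(1) by (simp add: weighted_graph_def)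
    then show ?thesis by induction (use assms(2,3) in auto)
  qed
  then show ?thesis by blast
qed

lemma Gam_zero_imp_constant:
  assumes G: "weighted_graph G" and zero: "\<And>x. Gam G f f x = 0"
  shows "f y = f x"
proof -
  have "f b = f a" if "adj G a b" for a b
  proof -
    have "finite (nbrs G a)" using G by (simp add: weighted_graph_def)
    moreover have "(\<Sum>y\<in>nbrs G a. eweight G a y / vweight G a * (f y - f a)\<^sup>2) = 0"
      using zero[of a] by (simp add: Gam_self_eq)
    moreover have "\<And>y. y \<in> nbrs G a \<Longrightarrow> 0 \<le> eweight G a y / vweight G a * (f y - f a)\<^sup>2"
      by (intro mult_nonneg_nonneg less_imp_le[OF transition_rate_pos[OF G]]) auto
    ultimately have "eweight G a b / vweight G a * (f b - f a)\<^sup>2 = 0"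
      using that by (subst (asm) sum_nonneg_eq_0_iff) (auto simp: nbrs_def)
    moreover have "eweight G a b / vweight G a > 0"
      using that by (intro transition_rate_pos[OF G]) (simp add: nbrs_def)
    ultimately have "(f b - f a)\<^sup>2 = 0" by (metis mult_eq_0_iff less_irrefl)
    then show ?thesis by simp
  qed
  then have "{b. f b = f x} = UNIV"
    by (intro connected_adj_closed[OF G, of x]) auto
  then show ?thesis by blast
qed

section \<open>A Liouville property\<close>

text \<open>The operator \<open>I + \<epsilon>\<Delta>\<close> preserves upper bounds: it replaces \<open>g x\<close> by a convex combination of \<open>g x\<close>
  and the values of \<open>g\<close> at the neighbours of \<open>x\<close>.\<close>

lemma bounded_geometry_markov:
  assumes G: "weighted_graph G" and "bounded_geometry G"
  obtains e where "e > 0" "\<And>g M x. (\<And>y. g y \<le> M) \<Longrightarrow> g x + e * laplacian G g x \<le> M"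
proof -
  obtain C where C: "C > 0"
    "\<And>x. real (card (nbrs G x)) \<le> C" "\<And>x. 1 / C \<le> vweight G x"
    "\<And>x y. adj G x y \<Longrightarrow> eweight G x y \<le> C"
    using assms(2) unfolding bounded_geometry_def by blast
  define D where "D x = (\<Sum>y\<in>nbrs G x. eweight G x y / vweight G x)" for x
  have D: "D x \<le> C ^ 3" for x
  proof -
    have "eweight G x y / vweight G x \<le> C\<^sup>2" if "y \<in> nbrs G x" for y
    proof -
      have "eweight G x y / vweight G x \<le> C / (1 / C)"
        using C that by (intro frac_le) (auto simp: nbrs_def)
      then show ?thesis by (simp add: power2_eq_square)
    qed
    then have "D x \<le> of_nat (card (nbrs G x)) * C\<^sup>2"
      unfolding D_def by (rule sum_bounded_above)
    also have "\<dots> \<le> C * C\<^sup>2" using C by (intro mult_right_mono) auto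
    finally show ?thesis by (simp add: power3_eq_cube power2_eq_square)
  qed
  show thesis
  proof (rule that[of "1 / C ^ 3"])
    show "1 / C ^ 3 > 0" using C by simp
    fix g :: "'a \<Rightarrow> real" and M x assume M: "\<And>y. g y \<le> M"
    have "laplacian G g x \<le> (\<Sum>y\<in>nbrs G x. eweight G x y / vweight G x * (M - g x))"
      unfolding laplacian_def using transition_rate_pos[OF G] M
      by (intro sum_mono mult_left_mono) (auto simp: less_imp_le)
    also have "\<dots> = D x * (M - g x)" by (simp add: D_def sum_distrib_right)
    also have "\<dots> \<le> C ^ 3 * (M - g x)" using D M by (intro mult_right_mono) auto
    finally show "g x + 1 / C ^ 3 * laplacian G g x \<le> M"
      using C(1) by (simp add: field_simps)
  qed
qed

lemma harmonic_Gam_subharmonic_imp_zero: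
  assumes G: "weighted_graph G" "bounded_geometry G"
    and bdd: "bounded (range f)" and harm: "\<And>x. laplacian G f x = 0"
    and sub: "\<And>x. laplacian G (Gam G f f) x \<ge> 0"
  shows "Gam G f f x = 0"
proof -
  let ?u = "Gam G f f"
  obtain e where e: "e > 0" "\<And>g M x. (\<And>y. g y \<le> M) \<Longrightarrow> g x + e * laplacian G g x \<le> M"
    using bounded_geometry_markov[OF G] by blast
  obtain a where a: "\<And>x. \<bar>f x\<bar> \<le> a"
    using bdd by (auto simp: bounded_iff)
  have bound: "f y * f y + 2 * e * real n * ?u y \<le> a * a" for n y
  proof (induction n arbitrary: y)
    case 0
    show ?case using mult_mono[OF a[of y] a[of y]] a[of y]
      by (simp add: abs_mult_self_eq)
  next
    case (Suc n)
    have "laplacian G (\<lambda>y. f y * f y) y = 2 * ?u y"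
      using harm by (simp add: Gam_def)
    then have "laplacian G (\<lambda>y. f y * f y + 2 * e * real n * ?u y) y
        = 2 * ?u y + 2 * e * real n * laplacian G ?u y"
      by (simp add: laplacian_add_scaled)
    also have "\<dots> \<ge> 2 * ?u y" using sub[of y] e(1) by simp
    finally have "e * (2 * ?u y) \<le> e * laplacian G (\<lambda>y. f y * f y + 2 * e * real n * ?u y) y"
      using e(1) by simp
    moreover have "f y * f y + 2 * e * real n * ?u y
        + e * laplacian G (\<lambda>y. f y * f y + 2 * e * real n * ?u y) y \<le> a * a"
      by (rule e(2)) (rule Suc.IH)
    ultimately show ?case by (simp add: algebra_simps)
  qed
  have "\<not> ?u x > 0"
  proof
    assume "?u x > 0"
    then have "2 * e * ?u x > 0" using e(1) by simp
    then obtain n where "a * a < real n * (2 * e * ?u x)"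
      using reals_Archimedean3 by blast
    moreover have "f x * f x \<ge> 0" by simp
    ultimately show False using bound[of x n] by (simp add: algebra_simps)
  qed
  then show ?thesis using Gam_self_nonneg[OF G(1), of f x] by linarith
qed

lemma CD0_outside_Gam_subharmonic:
  assumes G: "weighted_graph G" and "CD0_outside G A" "x \<notin> A"
    and harm: "\<And>x. laplacian G f x = 0"
  shows "laplacian G (Gam G f f) x \<ge> 0"
proof -
  have nonneg: "be_curvature G x \<ge> 0"
    using assms(2,3) by (simp add: CD0_outside_def)
  obtain K where K: "curv_bound G x K" "K \<ge> 0"
  proof (cases "be_curvature G x")
    case (real K)
    with nonneg be_curvature_greatest(1)[OF real] show ?thesis
      by (intro that[of K]) auto
  next
    case PInf
    then have "0 < Sup {ereal K |K. curv_bound G x K}" by (simp add: be_curvature_def)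
    then show ?thesis using that by (auto simp: less_Sup_iff intro: less_imp_le)
  next
    case MInf
    with nonneg show ?thesis by simp
  qed
  have "0 \<le> K * Gam G f f x" using K(2) Gam_self_nonneg[OF G] by simp
  also have "\<dots> \<le> Gam2 G f x" using K(1) by (simp add: curv_bound_def)
  also have "Gam G f (laplacian G f) x = 0"
    using harm by (simp add: Gam_def laplacian_def)
  then have "Gam2 G f x = 1 / 2 * laplacian G (Gam G f f) x"
    by (simp add: Gam2_def)
  finally show ?thesis by simp
qed

section \<open>Balls and spheres\<close>

lemma gdist_walk:
  assumes "weighted_graph G"
  shows "(adj G ^^ gdist G x y) x y"
proof -
  have "\<exists>n. (adj G ^^ n) x y"
    using assms by (simp add: weighted_graph_def rtranclp_power)
  then show ?thesis unfolding gdist_def by (rule LeastI_ex)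
qed

lemma gdist_adj_le:
  assumes "weighted_graph G" "adj G y z"
  shows "gdist G z x \<le> gdist G y x + 1"
proof -
  have "adj G z y" using assms by (auto simp: weighted_graph_def symp_def)
  then have "(adj G ^^ Suc (gdist G y x)) z x"
    using gdist_walk[OF assms(1)] by (rule relpowp_Suc_I2)
  then have "(LEAST n. (adj G ^^ n) z x) \<le> Suc (gdist G y x)" by (rule Least_le)
  then show ?thesis unfolding gdist_def[of G z] by simp
qed

lemma finite_gball:
  assumes "weighted_graph G"
  shows "finite (gball G x n)"
proof (induction n)
  case 0
  have "gball G x 0 \<subseteq> {x}"
  proof
    fix y assume "y \<in> gball G x 0"
    then show "y \<in> {x}" using gdist_walk[OF assms, of y x] by (simp add: gball_def)
  qed
  then show ?case by (rule finite_subset) simp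
next
  case (Suc n)
  have "gball G x (Suc n) \<subseteq> gball G x n \<union> (\<Union>z\<in>gball G x n. nbrs G z)"
  proof
    fix y assume y: "y \<in> gball G x (Suc n)"
    show "y \<in> gball G x n \<union> (\<Union>z\<in>gball G x n. nbrs G z)"
    proof (cases "gdist G y x = Suc n")
      case True
      then have "(adj G ^^ Suc n) y x" using gdist_walk[OF assms, of y x] by simp
      then obtain z where z: "adj G y z" "(adj G ^^ n) z x"
        by (rule relpowp_Suc_E2)
      have "z \<in> gball G x n"
        using z(2) by (auto simp: gball_def gdist_def intro: Least_le)
      moreover have "y \<in> nbrs G z"
        using z(1) assms by (auto simp: nbrs_def weighted_graph_def symp_def)
      ultimately show ?thesis by blast
    qed (use y in \<open>auto simp: gball_def\<close>)
  qed
  moreover have "finite (nbrs G z)" for z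
    using assms by (simp add: weighted_graph_def)
  ultimately show ?case using Suc by (auto intro: finite_subset)
qed

lemma finite_gsphere:
  assumes "weighted_graph G"
  shows "finite (gsphere G x n)"
  by (rule finite_subset[OF _ finite_gball[OF assms, of x n]])
    (auto simp: gsphere_def gball_def)

section \<open>The maximum principle on balls\<close>

lemma harmonic_max_nbrs_eq:
  assumes G: "weighted_graph G" and harm: "laplacian G f x = 0"
    and le: "\<And>y. y \<in> nbrs G x \<Longrightarrow> f y \<le> f x" and y: "y \<in> nbrs G x"
  shows "f y = f x"
proof -
  have "finite (nbrs G x)" using G by (simp add: weighted_graph_def)
  moreover have "(\<Sum>y\<in>nbrs G x. eweight G x y / vweight G x * (f x - f y)) = 0"
    using harm
    by (simp add: laplacian_def right_diff_distrib sum_subtractf)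
  moreover have "0 \<le> eweight G x z / vweight G x * (f x - f z)" if "z \<in> nbrs G x" for z
    using transition_rate_pos[OF G that] le[OF that] by (intro mult_nonneg_nonneg) auto
  ultimately have "eweight G x y / vweight G x * (f x - f y) = 0"
    using y by (subst (asm) sum_nonneg_eq_0_iff) auto
  moreover have "eweight G x y / vweight G x \<noteq> 0"
    using transition_rate_pos[OF G y] by (rule less_imp_neq[symmetric])
  ultimately show ?thesis by (metis mult_eq_0_iff right_minus_eq)
qed

lemma harmonic_nonpos_on_ball:
  assumes G: "weighted_graph G" and ne: "gball G x0 R \<noteq> UNIV"
    and harm: "\<And>x. x \<in> gball G x0 R \<Longrightarrow> laplacian G f x = 0"
    and zero: "\<And>x. x \<in> gsphere G x0 (R + 1) \<Longrightarrow> f x \<le> 0"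
    and x: "x \<in> gball G x0 (R + 1)"
  shows "f x \<le> 0"
proof (rule ccontr)
  let ?B = "gball G x0 (R + 1)"
  assume "\<not> f x \<le> 0"
  then have "f x > 0" by simp
  have fin: "finite (f ` ?B)" using finite_gball[OF G] by blast
  have "Max (f ` ?B) \<in> f ` ?B" using fin x by (intro Max_in) auto
  then obtain m where m: "m \<in> ?B" and "f m = Max (f ` ?B)" by (metis imageE)
  then have m_max: "f y \<le> f m" if "y \<in> ?B" for y
    using fin that by simp
  have pos: "f m > 0" using \<open>f x > 0\<close> m_max[OF x] by linarith
  have interior: "y \<in> gball G x0 R" if "y \<in> ?B" "f y = f m" for y
    using that zero[of y] pos by (force simp: gball_def gsphere_def)
  \<comment> \<open>The set where the positive maximum is attained stays off the sphere and is closed under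
    taking neighbours, so the ball would exhaust the graph.\<close>
  let ?A = "{y \<in> gball G x0 R. f y = f m}"
  have "?A = UNIV"
  proof (rule connected_adj_closed[OF G])
    show "m \<in> ?A" using interior[OF m] by simp
    fix y z assume y: "y \<in> ?A" and yz: "adj G y z"
    have nb: "w \<in> ?B" if "w \<in> nbrs G y" for w
      using gdist_adj_le[OF G, of y w x0] that y by (simp add: gball_def nbrs_def)
    have "f z = f y"
      using harm m_max nb y yz
      by (intro harmonic_max_nbrs_eq[OF G]) (auto simp: nbrs_def)
    then show "z \<in> ?A" using interior[of z] nb[of z] y yz by (auto simp: nbrs_def)
  qed
  then show False using ne by auto
qed

lemma harmonic_zero_on_ball:
  assumes G: "weighted_graph G" and ne: "gball G x0 R \<noteq> UNIV"
    and harm: "\<And>x. laplacian G f x = 0"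
    and zero: "\<And>x. x \<in> gsphere G x0 (R + 1) \<Longrightarrow> f x = 0"
    and x: "x \<in> gball G x0 (R + 1)"
  shows "f x = 0"
proof -
  have "f x \<le> 0"
    by (rule harmonic_nonpos_on_ball[OF G ne harm _ x]) (simp add: zero)
  moreover have "- f x \<le> 0"
    by (rule harmonic_nonpos_on_ball[OF G ne _ _ x]) (simp_all add: zero laplacian_uminus harm)
  ultimately show ?thesis by linarith
qed

lemma bounded_harmonic_zero_on_sphere_imp_zero:
  assumes G: "weighted_graph G" "bounded_geometry G" and ne: "gball G x0 R \<noteq> UNIV"
    and CD: "CD0_outside G (gball G x0 R)"
    and f: "f \<in> bounded_harmonic G"
    and zero: "\<And>x. x \<in> gsphere G x0 (R + 1) \<Longrightarrow> f x = 0"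
  shows "f x = 0"
proof -
  have harm: "laplacian G f y = 0" for y using f by (simp add: bounded_harmonic_def)
  have ball: "f y = 0" if "y \<in> gball G x0 (R + 1)" for y
    by (rule harmonic_zero_on_ball[OF G(1) ne harm _ that]) (rule zero)
  have "laplacian G (Gam G f f) y \<ge> 0" for y
  proof (cases "y \<in> gball G x0 R")
    case True
    have "z \<in> gball G x0 (R + 1)" if "z \<in> nbrs G y" for z
      using gdist_adj_le[OF G(1), of y z x0] that True by (simp add: gball_def nbrs_def)
    moreover have "y \<in> gball G x0 (R + 1)" using True by (simp add: gball_def)
    ultimately have "f y = 0" "\<And>z. z \<in> nbrs G y \<Longrightarrow> f z = 0" by (blast intro: ball)+
    then have "Gam G f f y = 0" by (simp add: Gam_self_eq)
    then show ?thesis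
      by (rule laplacian_nonneg_at_zero[OF G(1)]) (rule Gam_self_nonneg[OF G(1)])
  next
    case False
    then show ?thesis by (rule CD0_outside_Gam_subharmonic[OF G(1) CD _ harm])
  qed
  with f have "Gam G f f y = 0" for y
    by (intro harmonic_Gam_subharmonic_imp_zero[OF G _ harm]) (auto simp: bounded_harmonic_def)
  then have "f x = f x0" by (rule Gam_zero_imp_constant[OF G(1)])
  moreover have "(adj G ^^ 0) x0 x0" by simp
  then have "gdist G x0 x0 \<le> 0" unfolding gdist_def by (rule Least_le)
  then have "x0 \<in> gball G x0 (R + 1)" unfolding gball_def by simp
  then have "f x0 = 0" by (rule ball)
  ultimately show ?thesis by simp
qed

section \<open>Function spaces determined by finitely many values\<close>

lemma sum_fun_at:
  fixes g :: "'b \<Rightarrow> 'a \<Rightarrow> real"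
  shows "(\<Sum>y\<in>A. g y) x = (\<Sum>y\<in>A. g y x)"
  by (induction A rule: infinite_finite_induct) simp_all

text \<open>If the elements of a space of functions are determined by their values on a finite set, then
  its dimension is at most the size of that set: restriction embeds it into the span of the
  indicator functions of the points.\<close>

lemma dim_le_card_of_determining_set:
  fixes U :: "('v \<Rightarrow> real) set"
  assumes U: "fun_space.subspace U" and S: "finite S"
    and inj: "\<And>f. f \<in> U \<Longrightarrow> (\<And>x. x \<in> S \<Longrightarrow> f x = 0) \<Longrightarrow> f = 0"
  shows "finite_dim U \<and> fun_space.dim U \<le> card S"
proof -
  let ?s = "\<lambda>(c::real) (f::'v \<Rightarrow> real) x. c * f x"
  define r :: "('v \<Rightarrow> real) \<Rightarrow> 'v \<Rightarrow> real" where "r f x = (if x \<in> S then f x else 0)" for f x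
  define E where "E = (\<lambda>y x. if x = y then 1 else (0::real)) ` S"
  interpret r: Vector_Spaces.linear ?s ?s r
    by unfold_locales (auto simp: r_def fun_eq_iff)
  have r_span: "r f \<in> fun_space.span E" for f
  proof -
    have "r f = (\<Sum>y\<in>S. (\<lambda>x. f y * (if x = y then 1 else 0)))"
      using S by (auto simp: r_def fun_eq_iff sum_fun_at if_distrib cong: if_cong)
    also have "\<dots> \<in> fun_space.span E"
      by (intro fun_space.span_sum fun_space.span_scale[where c = "f _"] fun_space.span_base)
        (auto simp: E_def)
    finally show ?thesis .
  qed
  obtain B where B: "B \<subseteq> U" "fun_space.independent B" "U \<subseteq> fun_space.span B"
    "card B = fun_space.dim U"
    using fun_space.basis_exists by blast
  have span: "fun_space.span B = U"
    using B(1,3) fun_space.span_minimal[OF B(1) U] by blast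
  have inj_r: "inj_on r (fun_space.span B)"
    unfolding r.inj_on_iff_eq_0[OF fun_space.subspace_span]
  proof (intro ballI impI)
    fix f assume f: "f \<in> fun_space.span B" "r f = 0"
    then have "f x = 0" if "x \<in> S" for x
      using that by (auto simp: r_def fun_eq_iff split: if_splits)
    then show "f = 0" using f(1) span by (intro inj) auto
  qed
  have "fun_space.independent (r ` B)"
    by (rule r.independent_injective_image[OF B(2) inj_r])
  moreover have "r ` B \<subseteq> fun_space.span E" using r_span by blast
  moreover have "finite E" using S by (simp add: E_def)
  ultimately have rB: "finite (r ` B)" "card (r ` B) \<le> card E"
    using fun_space.independent_span_bound by blast+
  have inj_B: "inj_on r B"
    by (rule inj_on_subset[OF inj_r fun_space.span_superset])
  have "finite B" using rB(1) inj_B by (rule finite_imageD)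
  moreover have "card B \<le> card S"
    using rB(2) card_image[OF inj_B] card_image_le[OF S] unfolding E_def by (metis le_trans)
  ultimately show ?thesis using span B(4) unfolding finite_dim_def by auto
qed

theorem theorem1p2:
  fixes G :: "'v wgraph" and x0 :: 'v and R0 :: nat
  assumes "weighted_graph G"
    and "bounded_geometry G"
    and "gball G x0 R0 \<noteq> UNIV"
    and "CD0_outside G (gball G x0 R0)"
  shows "finite_dim (bounded_harmonic G) \<and>
         fun_space.dim (bounded_harmonic G) \<le> card (gsphere G x0 (R0 + 1)) \<and>
         finite (gsphere G x0 (R0 + 1))"
proof -
  have S: "finite (gsphere G x0 (R0 + 1))" by (rule finite_gsphere[OF assms(1)])
  moreover have "f = 0"
    if "f \<in> bounded_harmonic G" "\<And>x. x \<in> gsphere G x0 (R0 + 1) \<Longrightarrow> f x = 0" for f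
    using bounded_harmonic_zero_on_sphere_imp_zero[OF assms that] by (simp add: fun_eq_iff)
  ultimately show ?thesis
    using dim_le_card_of_determining_set[OF subspace_bounded_harmonic S, of G] by blast
qed

end
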